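(* Let $Y(\alpha,0)$ be a smooth toric hyperkähler manifold with nonempty core. Then the canonical open sets $U_\epsilon\cong T^*X(\mathcal{A}_\epsilon)$, $\epsilon\in\Theta_{cpt}$, form a covering of $Y(\alpha,0)$, i.e. $Y(\alpha,0)=\bigcup_{\epsilon\in\Theta_{cpt}}U_\epsilon$: the cotangent bundles of the compact toric varieties in the core are enough to glue $Y(\alpha,0)$.
   Context: Let $T^d$ be the real $d$-torus with Lie algebra $\mathfrak{t}\cong\mathbb{R}^d$, standard basis $e_1,\dots,e_d$ and dual basis $e_1^*,\dots,e_d^*$. Let $M\subset T^d$ be a connected $m$-dimensional subtorus with Lie algebra $\mathfrak{m}$ and complexification $M_{\mathbb{C}}$, and $N=T^d/M$ with Lie algebra $\mathfrak{n}=\mathfrak{t}/\mathfrak{m}$ of dimension $n=d-m$. There are exact sequences $0\to\mathfrak{m}\xrightarrow{\iota}\mathfrak{t}\xrightarrow{\pi}\mathfrak{n}\to0$ and $0\to\mathfrak{n}^*\xrightarrow{\pi^*}\mathfrak{t}^*\xrightarrow{\iota^*}\mathfrak{m}^*\to0$. Put $u_i=\pi(e_i)$, assumed to be primitive vectors of the lattice $\mathfrak{n}_{\mathbb{Z}}=\pi(\mathbb{Z}^d)$. $T^d$ acts on $\mathbb{H}^d\cong\mathbb{C}^d\times\mathbb{C}^d$ by $(z,w)\zeta=(z\zeta,w\zeta^{-1})$; $M$ has hyperkähler moment map $\mu=(\mu_{\mathbb{R}},\mu_{\mathbb{C}}):\mathbb{H}^d\to\mathfrak{m}^*\times\mathfrak{m}^*_{\mathbb{C}}$,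 $\mu_{\mathbb{R}}(z,w)=\frac12\sum_i(|z_i|^2-|w_i|^2)\iota^*e_i^*$, $\mu_{\mathbb{C}}(z,w)=\sum_iz_iw_i\,\iota^*e_i^*$. For $\alpha\in\mathfrak{m}^*$, $Y(\alpha,0)=\mu^{-1}(\alpha,0)/M$. "Smooth" means: $\{u_i\}$ is regular (every $n$ linearly independent vectors among the $u_i$ form a $\mathbb{Z}$-basis of $\mathfrak{n}_{\mathbb{Z}}$) and $(\alpha,0)$ is a regular value of $\mu$. Semi-stability and GIT description: $(z,w)\in\mu_{\mathbb{C}}^{-1}(0)$ is $\alpha$-semi-stable if $\alpha\in\sum_i\mathbb{R}_{\ge0}|z_i|^2\iota^*e_i^*+\sum_i\mathbb{R}_{\ge0}|w_i|^2(-\iota^*e_i^* )$. In the smooth case $Y(\alpha,0)$ is identified with the geometric quotient $\mu_{\mathbb{C}}^{-1}(0)^{\alpha\text{-}ss}/M_{\mathbb{C}}$. Arrangements: choose a lift $\lambda\in\mathbb{R}^d$ with $\alpha=\sum_i\lambda_i\iota^*e_i^*$, and let $\mathcal{A}=\{(H_i,u_i)\}$, $H_i=\{x\in\mathfrak{n}^*\mid\langle u_i,x\rangle+\lambda_i=0\}$. Let $\Theta$ be the set of maps $\epsilon:\{1,\dots,d\}\to\{-1,1\}$. For $\epsilon\in\Theta$, $\mathcal{A}_\epsilon$ is the arrangement with the same hyperplanes and normals $\epsilon(i)u_i$, with associated polytope (polyhedron) $\Delta_\epsilon=\{x\in\mathfrak{n}^*\mid\epsilon(i)(\langle u_i,x\rangle+\lambda_i)\ge0\text{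 for all }i\}$. Put $\Theta_{cpt}=\{\epsilon\in\Theta\mid\Delta_\epsilon\text{ bounded}\}$. Toric varieties, core and open sets: let $J=\{i\mid\epsilon(i)=1\}$ and $\bar J$ its complement. Let $(\mathbb{C}^d)^{\alpha\text{-}ss}_\epsilon$ be the set of $(z_J,w_{\bar J})\in\mathbb{C}^d$ (coordinates $z_i$, $i\in J$, and $w_i$, $i\in\bar J$) with $\alpha\in\sum_{i\in J}\mathbb{R}_{\ge0}|z_i|^2\iota^*e_i^*+\sum_{i\in\bar J}\mathbb{R}_{\ge0}|w_i|^2(-\iota^*e_i^* )$. The toric variety of $\mathcal{A}_\epsilon$ is $X(\mathcal{A}_\epsilon)=(\mathbb{C}^d)^{\alpha\text{-}ss}_\epsilon/M_{\mathbb{C}}$; it is identified with the component $Z_\epsilon=\{[z,w]\in Y(\alpha,0)\mid w_i=0\text{ if }\epsilon(i)=1,\ z_i=0\text{ if }\epsilon(i)=-1\}$. The core of $Y(\alpha,0)$ is $\bigcup_{\epsilon\in\Theta_{cpt}}Z_\epsilon$; it is nonempty iff some $\Delta_\epsilon$ is nonempty and bounded. The canonical open set $U_\epsilon\subset Y(\alpha,0)$ is the quotient by $M_{\mathbb{C}}$ of $\{(z,w)\in\mu_{\mathbb{C}}^{-1}(0)\mid(z_J,w_{\bar J})\in(\mathbb{C}^d)^{\alpha\text{-}ss}_\epsilon\}$ (the remaining $d$ coordinates being unrestricted apart from $\mu_{\mathbb{C}}=0$). It is a known result that, when $X(\mathcal{A}_\epsilon)\neq\emptyset$, $U_\epsilon$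 is an open subset isomorphic to the cotangent bundle $T^*X(\mathcal{A}_\epsilon)$. *)

theory Defs
  imports "HOL-Analysis.Analysis"
begin

section \<open>Tori\<close>

definition real_torus :: "(complex^'d) set" where
  "real_torus = {t. \<forall>i. norm (t $ i) = 1}"

(* vec carries the componentwise ring structure, so s * t is the torus multiplication. *)
definition subtorus :: "(complex^'d) set \<Rightarrow> bool" where
  "subtorus M \<longleftrightarrow> M \<subseteq> real_torus \<and> closed M \<and> connected M \<and> 1 \<in> M \<and>
     (\<forall>s\<in>M. \<forall>t\<in>M. s * t \<in> M) \<and> (\<forall>t\<in>M. (\<chi> i. inverse (t $ i)) \<in> M)"

(* Normalised so that the kernel of the exponential map R^d -> T^d is the lattice Z^d. *)
definition torus_exp :: "complex^'d \<Rightarrow> complex^'d" where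
  "torus_exp \<zeta> = (\<chi> i. exp (2 * complex_of_real pi * \<i> * \<zeta> $ i))"

definition lie_algebra :: "(complex^'d) set \<Rightarrow> (real^'d) set" where
  "lie_algebra M = {v. \<forall>s::real. torus_exp (\<chi> i. complex_of_real (s * v $ i)) \<in> M}"

(* The connected subgroup of (C^* )^d whose Lie algebra is the complexified Lie algebra of M. *)
definition complexification :: "(complex^'d) set \<Rightarrow> (complex^'d) set" where
  "complexification M =
     {torus_exp (\<chi> i. Complex (a $ i) (b $ i)) | a b. a \<in> lie_algebra M \<and> b \<in> lie_algebra M}"

definition integer_lattice :: "(real^'d) set" where
  "integer_lattice = {x. \<forall>i. x $ i \<in> \<int>}"

definition primitive_in :: "'n::real_vector set \<Rightarrow> 'n \<Rightarrow> bool" where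
  "primitive_in L v \<longleftrightarrow>
     v \<in> L \<and> v \<noteq> 0 \<and> (\<forall>(k::int) v'. v' \<in> L \<and> v = of_int k *\<^sub>R v' \<longrightarrow> \<bar>k\<bar> = 1)"

definition int_basis :: "'n::real_vector set \<Rightarrow> 'n set \<Rightarrow> bool" where
  "int_basis L B \<longleftrightarrow> finite B \<and>
     L = {\<Sum>b\<in>B. of_int (k b) *\<^sub>R b | k :: 'n \<Rightarrow> int. True} \<and>
     (\<forall>k :: 'n \<Rightarrow> int. (\<Sum>b\<in>B. of_int (k b) *\<^sub>R b) = 0 \<longrightarrow> (\<forall>b\<in>B. k b = 0))"

section \<open>The exact sequences\<close>

(* The Lie algebra of M and the quotient of R^d by it are represented by types 'm and 'n.
   These are normed spaces of arbitrary dimension (0 included); they are finite-dimensional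
   by exactness, so the dual spaces are the types of bounded linear functionals and
   the choice of norm is irrelevant. *)
definition exact_seq ::
  "(complex^'d) set \<Rightarrow> ('m::real_normed_vector \<Rightarrow>\<^sub>L (real^'d)) \<Rightarrow>
    ((real^'d) \<Rightarrow>\<^sub>L 'n::real_normed_vector) \<Rightarrow> bool" where
  "exact_seq M \<iota> \<pi> \<longleftrightarrow>
     inj (blinfun_apply \<iota>) \<and> range (blinfun_apply \<iota>) = lie_algebra M \<and>
     surj (blinfun_apply \<pi>) \<and> {v. blinfun_apply \<pi> v = 0} = range (blinfun_apply \<iota>)"

definition dual_basis :: "'d::finite \<Rightarrow> (real^'d) \<Rightarrow>\<^sub>L real" where
  "dual_basis i = blinfun_inner_left (axis i 1)"

definition iota_star ::
  "('m::real_normed_vector \<Rightarrow>\<^sub>L (real^'d)) \<Rightarrow> ((real^'d) \<Rightarrow>\<^sub>L real) \<Rightarrow> 'm \<Rightarrow>\<^sub>L real" where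
  "iota_star \<iota> f = f o\<^sub>L \<iota>"

definition normal :: "((real^'d) \<Rightarrow>\<^sub>L 'n::real_normed_vector) \<Rightarrow> 'd::finite \<Rightarrow> 'n" where
  "normal \<pi> i = blinfun_apply \<pi> (axis i 1)"

definition quotient_lattice :: "((real^'d) \<Rightarrow>\<^sub>L 'n::real_normed_vector) \<Rightarrow> 'n set" where
  "quotient_lattice \<pi> = blinfun_apply \<pi> ` integer_lattice"

definition regular_normals :: "((real^'d) \<Rightarrow>\<^sub>L 'n::real_normed_vector) \<Rightarrow> bool" where
  "regular_normals \<pi> \<longleftrightarrow>
     (\<forall>B \<subseteq> range (normal \<pi>). independent B \<and> card B = dim (UNIV :: 'n set) \<longrightarrow>
        int_basis (quotient_lattice \<pi>) B)"

section \<open>The hyperkaehler moment map and quotient\<close>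

type_synonym 'd quat = "(complex^'d) \<times> (complex^'d)"

definition act :: "complex^'d \<Rightarrow> 'd::finite quat \<Rightarrow> 'd quat" where
  "act t p = ((\<chi> i. t $ i * fst p $ i), (\<chi> i. snd p $ i * inverse (t $ i)))"

definition orbit :: "(complex^'d) set \<Rightarrow> 'd::finite quat \<Rightarrow> 'd quat set" where
  "orbit G p = (\<lambda>t. act t p) ` G"

definition orbit_space :: "(complex^'d) set \<Rightarrow> 'd::finite quat set \<Rightarrow> 'd quat set set" where
  "orbit_space G S = orbit G ` S"

(* Openness in the quotient topology of an orbit space of S, for a set of orbits contained in S. *)
definition open_in_quotient :: "'d::finite quat set \<Rightarrow> 'd quat set set \<Rightarrow> bool" where
  "open_in_quotient S U \<longleftrightarrow> openin (top_of_set S) (\<Union>U)"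

definition mu_R :: "('m::real_normed_vector \<Rightarrow>\<^sub>L (real^'d)) \<Rightarrow> 'd::finite quat \<Rightarrow> 'm \<Rightarrow>\<^sub>L real" where
  "mu_R \<iota> p = (1/2) *\<^sub>R
     (\<Sum>i\<in>UNIV. ((norm (fst p $ i))\<^sup>2 - (norm (snd p $ i))\<^sup>2) *\<^sub>R iota_star \<iota> (dual_basis i))"

(* The complexified dual of the Lie algebra is the space of real-linear functionals with values
   in C; the product of c with a real functional f is  blinfun_scaleR_left c o f. *)
definition mu_C :: "('m::real_normed_vector \<Rightarrow>\<^sub>L (real^'d)) \<Rightarrow> 'd::finite quat \<Rightarrow> 'm \<Rightarrow>\<^sub>L complex" where
  "mu_C \<iota> p =
     (\<Sum>i\<in>UNIV. blinfun_scaleR_left (fst p $ i * snd p $ i) o\<^sub>L iota_star \<iota> (dual_basis i))"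

definition mu :: "('m::real_normed_vector \<Rightarrow>\<^sub>L (real^'d)) \<Rightarrow> 'd::finite quat \<Rightarrow>
    ('m \<Rightarrow>\<^sub>L real) \<times> ('m \<Rightarrow>\<^sub>L complex)" where
  "mu \<iota> p = (mu_R \<iota> p, mu_C \<iota> p)"

definition regular_value ::
  "('a::real_normed_vector \<Rightarrow> 'b::real_normed_vector) \<Rightarrow> 'b \<Rightarrow> bool" where
  "regular_value f y \<longleftrightarrow> (\<forall>x. f x = y \<longrightarrow> (\<exists>f'. (f has_derivative f') (at x) \<and> surj f'))"

definition level_set :: "('m::real_normed_vector \<Rightarrow>\<^sub>L (real^'d)) \<Rightarrow> ('m \<Rightarrow>\<^sub>L real) \<Rightarrow>
    'd::finite quat set" where
  "level_set \<iota> \<alpha> = {p. mu \<iota> p = (\<alpha>, 0)}"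

definition Y :: "(complex^'d) set \<Rightarrow> ('m::real_normed_vector \<Rightarrow>\<^sub>L (real^'d)) \<Rightarrow>
    ('m \<Rightarrow>\<^sub>L real) \<Rightarrow> 'd::finite quat set set" where
  "Y M \<iota> \<alpha> = orbit_space M (level_set \<iota> \<alpha>)"

definition smooth ::
  "('m::real_normed_vector \<Rightarrow>\<^sub>L (real^'d::finite)) \<Rightarrow> ((real^'d) \<Rightarrow>\<^sub>L 'n::real_normed_vector) \<Rightarrow>
    ('m \<Rightarrow>\<^sub>L real) \<Rightarrow> bool" where
  "smooth \<iota> \<pi> \<alpha> \<longleftrightarrow> regular_normals \<pi> \<and> regular_value (mu \<iota>) (\<alpha>, 0)"

section \<open>The GIT quotient\<close>

definition semistable :: "('m::real_normed_vector \<Rightarrow>\<^sub>L (real^'d)) \<Rightarrow> ('m \<Rightarrow>\<^sub>L real) \<Rightarrow>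
    'd::finite quat \<Rightarrow> bool" where
  "semistable \<iota> \<alpha> p \<longleftrightarrow> (\<exists>a b :: 'd \<Rightarrow> real. (\<forall>i. 0 \<le> a i \<and> 0 \<le> b i) \<and>
     \<alpha> = (\<Sum>i\<in>UNIV. (a i * (norm (fst p $ i))\<^sup>2) *\<^sub>R iota_star \<iota> (dual_basis i)) +
         (\<Sum>i\<in>UNIV. (b i * (norm (snd p $ i))\<^sup>2) *\<^sub>R (- iota_star \<iota> (dual_basis i))))"

definition semistable_set :: "('m::real_normed_vector \<Rightarrow>\<^sub>L (real^'d)) \<Rightarrow> ('m \<Rightarrow>\<^sub>L real) \<Rightarrow>
    'd::finite quat set" where
  "semistable_set \<iota> \<alpha> = {p. mu_C \<iota> p = 0 \<and> semistable \<iota> \<alpha> p}"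

definition Y_GIT :: "(complex^'d) set \<Rightarrow> ('m::real_normed_vector \<Rightarrow>\<^sub>L (real^'d)) \<Rightarrow>
    ('m \<Rightarrow>\<^sub>L real) \<Rightarrow> 'd::finite quat set set" where
  "Y_GIT M \<iota> \<alpha> = orbit_space (complexification M) (semistable_set \<iota> \<alpha>)"

section \<open>Arrangements, core and canonical open sets\<close>

definition Theta :: "('d::finite \<Rightarrow> int) set" where
  "Theta = {\<epsilon>. \<forall>i. \<epsilon> i \<in> {-1, 1}}"

definition polyhedron :: "((real^'d) \<Rightarrow>\<^sub>L 'n::real_normed_vector) \<Rightarrow> real^'d \<Rightarrow>
    ('d::finite \<Rightarrow> int) \<Rightarrow> ('n \<Rightarrow>\<^sub>L real) set" where
  "polyhedron \<pi> lam \<epsilon> =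
     {x. \<forall>i. of_int (\<epsilon> i) * (blinfun_apply x (normal \<pi> i) + lam $ i) \<ge> 0}"

definition Theta_cpt :: "((real^'d) \<Rightarrow>\<^sub>L 'n::real_normed_vector) \<Rightarrow> real^'d \<Rightarrow>
    ('d::finite \<Rightarrow> int) set" where
  "Theta_cpt \<pi> lam = {\<epsilon> \<in> Theta. bounded (polyhedron \<pi> lam \<epsilon>)}"

definition Z_comp :: "(complex^'d) set \<Rightarrow> ('m::real_normed_vector \<Rightarrow>\<^sub>L (real^'d)) \<Rightarrow>
    ('m \<Rightarrow>\<^sub>L real) \<Rightarrow> ('d::finite \<Rightarrow> int) \<Rightarrow> 'd quat set set" where
  "Z_comp M \<iota> \<alpha> \<epsilon> = orbit_space M
     {p \<in> level_set \<iota> \<alpha>. \<forall>i. (\<epsilon> i = 1 \<longrightarrow> snd p $ i = 0) \<and> (\<epsilon> i = -1 \<longrightarrow> fst p $ i = 0)}"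

definition core :: "(complex^'d) set \<Rightarrow> ('m::real_normed_vector \<Rightarrow>\<^sub>L (real^'d)) \<Rightarrow>
    ((real^'d) \<Rightarrow>\<^sub>L 'n::real_normed_vector) \<Rightarrow> ('m \<Rightarrow>\<^sub>L real) \<Rightarrow> real^'d \<Rightarrow>
    'd::finite quat set set" where
  "core M \<iota> \<pi> \<alpha> lam = (\<Union>\<epsilon>\<in>Theta_cpt \<pi> lam. Z_comp M \<iota> \<alpha> \<epsilon>)"

(* The coordinates z_i for eps(i) = 1 and w_i for eps(i) = -1, as one vector of C^d. *)
definition eps_coords :: "('d::finite \<Rightarrow> int) \<Rightarrow> 'd quat \<Rightarrow> complex^'d" where
  "eps_coords \<epsilon> p = (\<chi> i. if \<epsilon> i = 1 then fst p $ i else snd p $ i)"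

definition eps_semistable :: "('m::real_normed_vector \<Rightarrow>\<^sub>L (real^'d)) \<Rightarrow> ('m \<Rightarrow>\<^sub>L real) \<Rightarrow>
    ('d::finite \<Rightarrow> int) \<Rightarrow> (complex^'d) set" where
  "eps_semistable \<iota> \<alpha> \<epsilon> = {v. \<exists>a :: 'd \<Rightarrow> real. (\<forall>i. 0 \<le> a i) \<and>
     \<alpha> = (\<Sum>i | \<epsilon> i = 1. (a i * (norm (v $ i))\<^sup>2) *\<^sub>R iota_star \<iota> (dual_basis i)) +
         (\<Sum>i | \<epsilon> i \<noteq> 1. (a i * (norm (v $ i))\<^sup>2) *\<^sub>R (- iota_star \<iota> (dual_basis i)))}"

definition U_GIT :: "(complex^'d) set \<Rightarrow> ('m::real_normed_vector \<Rightarrow>\<^sub>L (real^'d)) \<Rightarrow>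
    ('m \<Rightarrow>\<^sub>L real) \<Rightarrow> ('d::finite \<Rightarrow> int) \<Rightarrow> 'd quat set set" where
  "U_GIT M \<iota> \<alpha> \<epsilon> = orbit_space (complexification M)
     {p. mu_C \<iota> p = 0 \<and> eps_coords \<epsilon> p \<in> eps_semistable \<iota> \<alpha> \<epsilon>}"

(* U_GIT transported to the hyperkaehler quotient along the identification of Y with Y_GIT,
   which sends the M-orbit of p to its orbit under the complexification of M. *)
definition U :: "(complex^'d) set \<Rightarrow> ('m::real_normed_vector \<Rightarrow>\<^sub>L (real^'d)) \<Rightarrow>
    ('m \<Rightarrow>\<^sub>L real) \<Rightarrow> ('d::finite \<Rightarrow> int) \<Rightarrow> 'd quat set set" where
  "U M \<iota> \<alpha> \<epsilon> =
     {Q \<in> Y M \<iota> \<alpha>. \<exists>p\<in>Q. orbit (complexification M) p \<in> U_GIT M \<iota> \<alpha> \<epsilon>}"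

end

theory Submission
  imports Defs
begin

text \<open>
  Everything takes place in \<open>\<real>\<^sup>d\<close>. Let \<open>S\<close> be the Lie algebra of the subtorus, that is, the kernel
  of \<open>\<pi>\<close>: the linear relations among the normals \<open>u\<^sub>i\<close>. A point \<open>x\<close> of the dual of the quotient
  is recorded by the values \<open>c\<^sub>i = \<langle>u\<^sub>i, x\<rangle> + \<lambda>\<^sub>i\<close>, and the vectors \<open>c\<close> arising in this way form the affine
  space \<open>\<lambda> + S\<^sup>\<bottom>\<close> of all \<open>c\<close> with \<open>\<Sum>\<^sub>i c\<^sub>i \<iota>\<^sup>*e\<^sub>i\<^sup>* = \<alpha>\<close>. Both stability conditions depend only on which
  coordinates vanish: \<open>(z, w)\<close> is semi-stable iff some such \<open>c\<close> has \<open>z\<^sub>i \<noteq> 0\<close> where \<open>c\<^sub>i > 0\<close> and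
  \<open>w\<^sub>i \<noteq> 0\<close> where \<open>c\<^sub>i < 0\<close> (\<open>semistable_iff\<close>), and it lies over \<open>U\<^sub>\<epsilon>\<close> iff in addition the point can be
  taken in \<open>\<Delta>\<^sub>\<epsilon>\<close> (\<open>eps_semistable_iff\<close>). In particular the second condition is open and invariant
  under coordinatewise scaling by nonzero numbers, which gives openness of the \<open>U\<^sub>\<epsilon>\<close>.

  For the covering, take a witness \<open>c\<close> for a semi-stable point. Shrinking its support without
  changing any remaining sign keeps it a witness, so \<open>c\<close> may be taken to be a vertex of the arrangement
  (\<open>exists_conformal_vertex\<close>). It remains to see that every vertex lies in a chamber \<open>\<Delta>\<^sub>\<epsilon>\<close> with
  \<open>\<epsilon> \<in> \<Theta>\<^sub>c\<^sub>p\<^sub>t\<close>. At a vertex the normals of the hyperplanes through it span, so there is a relation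
  \<open>s \<in> S\<close> with \<open>s\<^sub>i = c\<^sub>i\<close> wherever \<open>c\<^sub>i \<noteq> 0\<close> (\<open>subspace_coordinates_prescribed\<close>). A bounded nonempty
  chamber exists because the core is nonempty, and it forces every coordinate to be nonzero on some relation
  (\<open>bounded_polyhedron_imp_relations_nonzero\<close>); hence a small perturbation of \<open>s\<close> within \<open>S\<close> has no
  zero coordinate and still agrees with \<open>c\<close> in sign. Let \<open>\<epsilon>\<close> be its sign vector. Then \<open>c\<close> lies in the
  chamber of \<open>\<epsilon>\<close>, and this chamber is bounded, since \<open>\<Sum>\<^sub>i s\<^sub>i (\<langle>u\<^sub>i, x\<rangle> + \<lambda>\<^sub>i) = \<Sum>\<^sub>i s\<^sub>i \<lambda>\<^sub>i\<close> is a sum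
  of nonnegative terms with a value independent of \<open>x\<close>
  (\<open>positive_relation_imp_bounded_polyhedron\<close>).
\<close>

section \<open>Sign vectors of linear subspaces\<close>

text \<open>Take a vector of minimal support among those in the affine space whose signs come from
  \<open>c0\<close>. If a nonzero direction were supported inside its support, moving along that direction until the
  first coordinate vanishes would give a smaller support. The last conclusion says that the result is
  a vertex: the coordinates vanishing at it determine a point of the affine space.\<close>
lemma exists_conformal_vertex:
  fixes c0 :: "real^'d::finite"
  assumes T: "subspace T"
  obtains c where "c - c0 \<in> T" "\<And>i. c $ i > 0 \<Longrightarrow> c0 $ i > 0" "\<And>i. c $ i < 0 \<Longrightarrow> c0 $ i < 0"
    "\<And>h. h \<in> T \<Longrightarrow> (\<And>i. c $ i = 0 \<Longrightarrow> h $ i = 0) \<Longrightarrow> h = 0"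
proof -
  define P where "P c \<longleftrightarrow> c - c0 \<in> T \<and> (\<forall>i. c $ i > 0 \<longrightarrow> c0 $ i > 0) \<and> (\<forall>i. c $ i < 0 \<longrightarrow> c0 $ i < 0)"
    for c
  have "P c0" using subspace_0[OF T] by (simp add: P_def)
  then obtain c where c: "P c" and
    min: "\<And>c'. P c' \<Longrightarrow> card {i. c $ i \<noteq> 0} \<le> card {i. c' $ i \<noteq> 0}"
    using ex_has_least_nat[of P c0 "\<lambda>c. card {i. c $ i \<noteq> 0}"] by blast
  have "h = 0" if h: "h \<in> T" and supp: "\<And>i. c $ i = 0 \<Longrightarrow> h $ i = 0" for h
  proof (rule ccontr)
    assume "h \<noteq> 0"
    then have ne: "{i. h $ i \<noteq> 0} \<noteq> {}" by (auto simp: vec_eq_iff)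
    define r where "r i = \<bar>c $ i / h $ i\<bar>" for i
    obtain k where k: "h $ k \<noteq> 0" and kmin: "\<And>j. h $ j \<noteq> 0 \<Longrightarrow> r k \<le> r j"
      using arg_min_if_finite[OF _ ne, of r] by (metis (mono_tags) finite_code mem_Collect_eq not_le)
    define t where "t = - (c $ k / h $ k)"
    define c' where "c' = c + t *\<^sub>R h"
    \<comment> \<open>The first coordinate to vanish along the line is the k-th, so no other one has changed sign.\<close>
    have small: "\<bar>t * h $ j\<bar> \<le> \<bar>c $ j\<bar>" for j
    proof (cases "h $ j = 0")
      case False
      have "\<bar>t\<bar> \<le> \<bar>c $ j\<bar> / \<bar>h $ j\<bar>" using kmin[OF False] by (simp add: t_def r_def abs_divide)
      with False show ?thesis by (simp add: abs_mult pos_le_divide_eq)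
    qed simp
    have c'j: "c' $ j = c $ j + t * h $ j" for j by (simp add: c'_def)
    have pos: "c $ j > 0" if "c' $ j > 0" for j using small[of j] that c'j[of j] by linarith
    have neg: "c $ j < 0" if "c' $ j < 0" for j using small[of j] that c'j[of j] by linarith
    have "(c - c0) + t *\<^sub>R h \<in> T" using c h T by (simp add: P_def subspace_add subspace_scale)
    then have "c' - c0 \<in> T" by (simp add: c'_def algebra_simps)
    with pos neg c have "P c'" by (auto simp: P_def)
    have "c' $ k = 0" using k by (simp add: c'j t_def)
    moreover have "c $ k \<noteq> 0" using k supp by blast
    moreover have "{i. c' $ i \<noteq> 0} \<subseteq> {i. c $ i \<noteq> 0}"
      using pos neg by (auto simp: neq_iff)
    ultimately have "{i. c' $ i \<noteq> 0} \<subset> {i. c $ i \<noteq> 0}" by blast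
    then have "card {i. c' $ i \<noteq> 0} < card {i. c $ i \<noteq> 0}" by (simp add: psubset_card_mono)
    with min[OF \<open>P c'\<close>] show False by simp
  qed
  with c show thesis using that unfolding P_def by blast
qed

text \<open>The hypothesis says that \<open>S\<close> together with the coordinate subspace of \<open>B\<close> has trivial
  orthogonal complement, hence their sum is everything; the component of \<open>\<sigma>\<close> in \<open>S\<close> differs from
  \<open>\<sigma>\<close> only in the coordinates of \<open>B\<close>.\<close>
lemma subspace_coordinates_prescribed:
  fixes S :: "(real^'d::finite) set"
  assumes S: "subspace S"
    and triv: "\<And>h. (\<And>s. s \<in> S \<Longrightarrow> h \<bullet> s = 0) \<Longrightarrow> (\<And>i. i \<in> B \<Longrightarrow> h $ i = 0) \<Longrightarrow> h = 0"
  obtains s where "s \<in> S" "\<And>j. j \<notin> B \<Longrightarrow> s $ j = \<sigma> $ j"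
proof -
  define R where "R = {v :: real^'d. \<forall>j. j \<notin> B \<longrightarrow> v $ j = 0}"
  have R: "subspace R" by (simp add: R_def subspace_def)
  define W where "W = {x + y | x y. x \<in> S \<and> y \<in> R}"
  have W: "subspace W" unfolding W_def using subspace_sums[OF S R] .
  have "span W = UNIV"
  proof (rule ccontr)
    assume "span W \<noteq> UNIV"
    then obtain h where h: "h \<noteq> 0" "\<And>x. x \<in> span W \<Longrightarrow> h \<bullet> x = 0"
      using span_not_univ_subset_hyperplane[of W] by (auto simp: subset_iff)
    have "h \<bullet> s = 0" if "s \<in> S" for s
    proof -
      have "s \<in> W" unfolding W_def using that subspace_0[OF R] by force
      then show ?thesis by (simp add: h(2) span_base)
    qed
    moreover have "h $ i = 0" if "i \<in> B" for i
    proof -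
      have "axis i 1 \<in> R" using that by (auto simp: R_def axis_def)
      then have "axis i 1 \<in> W" unfolding W_def using subspace_0[OF S] by force
      then have "h \<bullet> axis i 1 = 0" by (simp add: h(2) span_base)
      then show ?thesis by (simp add: inner_axis)
    qed
    ultimately show False using triv h(1) by blast
  qed
  then have "\<sigma> \<in> W" using W by (simp add: span_eq_iff[THEN iffD2])
  then obtain x y where "\<sigma> = x + y" "x \<in> S" "y \<in> R" by (auto simp: W_def)
  then show thesis using that[of x] by (auto simp: R_def)
qed

text \<open>Zero coordinates are removed one at a time: adding a small multiple of a vector of \<open>S\<close>
  that is nonzero there destroys no sign already present.\<close>
lemma subspace_perturb_nonzero:
  fixes S :: "(real^'d::finite) set"
  assumes S: "subspace S" and nz: "\<And>i. \<exists>s\<in>S. s $ i \<noteq> 0" and "s \<in> S"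
  obtains s' where "s' \<in> S" "\<And>i. s' $ i \<noteq> 0" "\<And>i. s $ i \<noteq> 0 \<Longrightarrow> s $ i * s' $ i > 0"
proof -
  have "\<exists>s'\<in>S. (\<forall>i. s' $ i \<noteq> 0) \<and> (\<forall>i. s $ i \<noteq> 0 \<longrightarrow> s $ i * s' $ i > 0)"
    using \<open>s \<in> S\<close>
  proof (induction "card {i. s $ i = 0}" arbitrary: s rule: less_induct)
    case less
    show ?case
    proof (cases "\<forall>i. s $ i \<noteq> 0")
      case True
      then show ?thesis using less.prems by (intro bexI[of _ s]) (auto simp: zero_less_mult_iff neq_iff)
    next
      case False
      then obtain i where i: "s $ i = 0" by blast
      obtain r where r: "r \<in> S" "r $ i \<noteq> 0" using nz by blast
      have "\<forall>\<^sub>F \<delta> in at_right 0. \<forall>j. s $ j \<noteq> 0 \<longrightarrow> s $ j * (s $ j + \<delta> * r $ j) > 0"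
      proof (rule eventually_all_finite)
        fix j
        show "\<forall>\<^sub>F \<delta> in at_right 0. s $ j \<noteq> 0 \<longrightarrow> s $ j * (s $ j + \<delta> * r $ j) > 0"
        proof (cases "s $ j = 0")
          case False
          have "((\<lambda>\<delta>. s $ j * (s $ j + \<delta> * r $ j)) \<longlongrightarrow> s $ j * (s $ j + 0 * r $ j)) (at_right 0)"
            by (intro tendsto_intros)
          moreover have "s $ j * (s $ j + 0 * r $ j) > 0" using False by (auto simp: zero_less_mult_iff)
          ultimately have "\<forall>\<^sub>F \<delta> in at_right 0. s $ j * (s $ j + \<delta> * r $ j) > 0"
            by (rule order_tendstoD)
          then show ?thesis by eventually_elim simp
        qed simp
      qed
      then have "\<forall>\<^sub>F \<delta> in at_right (0::real). \<delta> > 0 \<and> (\<forall>j. s $ j \<noteq> 0 \<longrightarrow> s $ j * (s $ j + \<delta> * r $ j) > 0)"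
        using eventually_at_right_less[of "0::real"] by eventually_elim simp
      then obtain \<delta> where \<delta>: "\<delta> > 0" "\<And>j. s $ j \<noteq> 0 \<Longrightarrow> s $ j * (s $ j + \<delta> * r $ j) > 0"
        using eventually_happens'[OF trivial_limit_at_right_real] by blast
      define q where "q = s + \<delta> *\<^sub>R r"
      have qj: "q $ j = s $ j + \<delta> * r $ j" for j by (simp add: q_def)
      have q: "q \<in> S" using S less.prems r by (simp add: q_def subspace_add subspace_scale)
      have same: "s $ j * q $ j > 0" if "s $ j \<noteq> 0" for j using \<delta>(2)[OF that] by (simp add: qj)
      have "q $ i \<noteq> 0" using i r \<delta>(1) by (simp add: qj)
      then have "{i. q $ i = 0} \<subset> {i. s $ i = 0}" using i same by fastforce
      then have "card {i. q $ i = 0} < card {i. s $ i = 0}" by (simp add: psubset_card_mono)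
      from less.hyps[OF this q] obtain s' where s': "s' \<in> S" "\<forall>i. s' $ i \<noteq> 0"
        "\<forall>i. q $ i \<noteq> 0 \<longrightarrow> q $ i * s' $ i > 0" by blast
      have "s $ j * s' $ j > 0" if "s $ j \<noteq> 0" for j
      proof -
        have "s $ j * q $ j > 0" using same[OF that] .
        moreover have "q $ j * s' $ j > 0" using s'(3) calculation by force
        ultimately show ?thesis by (auto simp: zero_less_mult_iff)
      qed
      with s' show ?thesis by blast
    qed
  qed
  then show thesis using that by blast
qed

text \<open>The combinatorial heart: read with \<open>S\<close> the space of relations among the normals, it
  moves any point of the arrangement to a vertex \<open>c\<close> in its closed cell and finds a chamber \<open>\<epsilon>\<close>
  containing \<open>c\<close> that carries a relation which is strictly positive for its signs. Such a relation is a
  certificate of boundedness.\<close>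
lemma exists_conformal_positive_relation:
  fixes S :: "(real^'d::finite) set"
  assumes S: "subspace S" and nz: "\<And>i. \<exists>s\<in>S. s $ i \<noteq> 0"
  obtains c \<epsilon> s where "\<And>v. v \<in> S \<Longrightarrow> (c - c0) \<bullet> v = 0"
    "\<And>i. c $ i > 0 \<Longrightarrow> c0 $ i > 0" "\<And>i. c $ i < 0 \<Longrightarrow> c0 $ i < 0"
    "\<epsilon> \<in> Theta" "\<And>i. of_int (\<epsilon> i) * c $ i \<ge> 0" "s \<in> S" "\<And>i. of_int (\<epsilon> i) * s $ i > 0"
proof -
  define T where "T = {h. \<forall>v\<in>S. h \<bullet> v = 0}"
  have "subspace T" by (simp add: T_def subspace_def inner_add_left)
  then obtain c where c: "c - c0 \<in> T" "\<And>i. c $ i > 0 \<Longrightarrow> c0 $ i > 0" "\<And>i. c $ i < 0 \<Longrightarrow> c0 $ i < 0"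
    and vertex: "\<And>h. h \<in> T \<Longrightarrow> (\<And>i. c $ i = 0 \<Longrightarrow> h $ i = 0) \<Longrightarrow> h = 0"
    using exists_conformal_vertex by metis
  obtain s0 where s0: "s0 \<in> S" "\<And>j. c $ j \<noteq> 0 \<Longrightarrow> s0 $ j = c $ j"
    using subspace_coordinates_prescribed[OF S, of "{i. c $ i = 0}" c] vertex
    by (simp add: T_def) blast
  obtain s where s: "s \<in> S" "\<And>i. s $ i \<noteq> 0" "\<And>i. s0 $ i \<noteq> 0 \<Longrightarrow> s0 $ i * s $ i > 0"
    using subspace_perturb_nonzero[OF S nz s0(1)] by blast
  define \<epsilon> :: "'d \<Rightarrow> int" where "\<epsilon> i = (if s $ i > 0 then 1 else -1)" for i
  show thesis
  proof (rule that[of c \<epsilon> s])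
    show "\<epsilon> \<in> Theta" by (simp add: Theta_def \<epsilon>_def)
    show "of_int (\<epsilon> i) * s $ i > 0" for i using s(2)[of i] by (auto simp: \<epsilon>_def)
    show "of_int (\<epsilon> i) * c $ i \<ge> 0" for i
      using s0(2)[of i] s(3)[of i] by (cases "c $ i = 0") (auto simp: \<epsilon>_def zero_less_mult_iff)
  qed (use c s(1) in \<open>auto simp: T_def\<close>)
qed

section \<open>Functionals on the quotient and bounded chambers\<close>

text \<open>An open mapping statement for a finite-dimensional source: on the orthogonal complement of the
  kernel the norm of the image is positive, so it is bounded below on the compact unit sphere there.\<close>
lemma blinfun_surj_bounded_preimage:
  fixes \<pi> :: "(real^'d::finite) \<Rightarrow>\<^sub>L 'n::real_normed_vector"
  assumes "surj (blinfun_apply \<pi>)"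
  obtains K where "K > 0" "\<And>v. \<exists>a. blinfun_apply \<pi> a = v \<and> norm a \<le> K * norm v"
proof -
  define S where "S = {a. blinfun_apply \<pi> a = 0}"
  have S: "subspace S" by (simp add: S_def subspace_def blinfun.add_right blinfun.scaleR_right)
  define W where "W = {a. \<forall>s\<in>S. s \<bullet> a = 0}"
  have Wclosed: "closed W"
  proof -
    have "W = (\<Inter>s\<in>S. {a. s \<bullet> a = 0})" by (auto simp: W_def)
    then show ?thesis by (auto intro: closed_hyperplane)
  qed
  have W: "subspace W" by (simp add: W_def subspace_def inner_add_right)
  have Wnz: "blinfun_apply \<pi> a \<noteq> 0" if "a \<in> W" "a \<noteq> 0" for a
    using that by (auto simp: W_def S_def)
  have ex: "\<exists>K>0. \<forall>a\<in>W. norm a \<le> K * norm (blinfun_apply \<pi> a)"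
  proof (cases "W \<inter> sphere 0 1 = {}")
    case True
    have "a = 0" if "a \<in> W" for a
    proof (rule ccontr)
      assume "a \<noteq> 0"
      then have "(1 / norm a) *\<^sub>R a \<in> W \<inter> sphere 0 1" using that W by (simp add: subspace_scale)
      with True show False by blast
    qed
    then show ?thesis by (intro exI[of _ 1]) force
  next
    case False
    have "compact (W \<inter> sphere 0 1)" using Wclosed compact_sphere by (rule closed_Int_compact)
    moreover have "continuous_on (W \<inter> sphere 0 1) (\<lambda>a. norm (blinfun_apply \<pi> a))"
      by (intro continuous_intros)
    ultimately obtain b where b: "b \<in> W \<inter> sphere 0 1"
      "\<And>a. a \<in> W \<inter> sphere 0 1 \<Longrightarrow> norm (blinfun_apply \<pi> b) \<le> norm (blinfun_apply \<pi> a)"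
      using continuous_attains_inf[OF _ False] by metis
    define m where "m = norm (blinfun_apply \<pi> b)"
    have m: "m > 0" using Wnz[of b] b(1) by (cases "b = 0") (auto simp: m_def)
    have "norm a \<le> (1 / m) * norm (blinfun_apply \<pi> a)" if "a \<in> W" for a
    proof (cases "a = 0")
      case nz: False
      then have "(1 / norm a) *\<^sub>R a \<in> W \<inter> sphere 0 1" using that W by (simp add: subspace_scale)
      from b(2)[OF this] have "m \<le> norm (blinfun_apply \<pi> a) / norm a"
        by (simp add: m_def blinfun.scaleR_right)
      with m nz show ?thesis by (simp add: field_simps)
    qed simp
    with m show ?thesis by (intro exI[of _ "1 / m"]) auto
  qed
  then obtain K where K: "K > 0" "\<And>a. a \<in> W \<Longrightarrow> norm a \<le> K * norm (blinfun_apply \<pi> a)" by blast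
  have "\<exists>a. blinfun_apply \<pi> a = v \<and> norm a \<le> K * norm v" for v
  proof -
    obtain b where b: "blinfun_apply \<pi> b = v" using assms by (metis surjD)
    obtain y z where yz: "y \<in> span S" "\<And>w. w \<in> span S \<Longrightarrow> orthogonal z w" "b = y + z"
      using orthogonal_subspace_decomp_exists[of S b] by metis
    have y: "y \<in> S" using yz(1) span_eq_iff S by blast
    have "z \<in> W" using yz(2) by (auto simp: W_def orthogonal_def span_base inner_commute)
    moreover have "blinfun_apply \<pi> z = v" using b y yz(3) by (simp add: S_def blinfun.add_right)
    ultimately show ?thesis using K(2)[of z] by blast
  qed
  with K(1) that show thesis by blast
qed

text \<open>Exactness of the dual sequence: functionals vanishing on the kernel come from the quotient.
  Continuity of the induced functional needs preimages of controlled norm.\<close>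
lemma functional_factors_through_quotient:
  fixes \<pi> :: "(real^'d::finite) \<Rightarrow>\<^sub>L 'n::real_normed_vector"
  assumes surj: "surj (blinfun_apply \<pi>)"
    and vanish: "\<And>a. blinfun_apply \<pi> a = 0 \<Longrightarrow> h \<bullet> a = 0"
  obtains x :: "'n \<Rightarrow>\<^sub>L real" where "\<And>a. blinfun_apply x (blinfun_apply \<pi> a) = h \<bullet> a"
proof -
  obtain K where K: "K > 0" "\<And>v. \<exists>a. blinfun_apply \<pi> a = v \<and> norm a \<le> K * norm v"
    using blinfun_surj_bounded_preimage[OF surj] by blast
  then obtain r where r: "\<And>v. blinfun_apply \<pi> (r v) = v" "\<And>v. norm (r v) \<le> K * norm v" by metis
  have eq: "h \<bullet> a = h \<bullet> b" if "blinfun_apply \<pi> a = blinfun_apply \<pi> b" for a b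
    using vanish[of "a - b"] that by (simp add: blinfun.diff_right inner_diff_right)
  have "bounded_linear (\<lambda>v. h \<bullet> r v)"
  proof (rule bounded_linear_intro[of _ "norm h * K"])
    show "h \<bullet> r (v + w) = h \<bullet> r v + h \<bullet> r w" for v w
      using eq[of "r (v + w)" "r v + r w"] by (simp add: r blinfun.add_right inner_add_right)
    show "h \<bullet> r (t *\<^sub>R v) = t *\<^sub>R (h \<bullet> r v)" for t v
      using eq[of "r (t *\<^sub>R v)" "t *\<^sub>R r v"] by (simp add: r blinfun.scaleR_right)
    show "norm (h \<bullet> r v) \<le> norm v * (norm h * K)" for v
    proof -
      have "norm (h \<bullet> r v) \<le> norm h * norm (r v)" by (simp add: Cauchy_Schwarz_ineq2)
      also have "\<dots> \<le> norm h * (K * norm v)" by (intro mult_left_mono r) simp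
      finally show ?thesis by (simp add: mult_ac)
    qed
  qed
  then have "blinfun_apply (Blinfun (\<lambda>v. h \<bullet> r v)) (blinfun_apply \<pi> a) = h \<bullet> a" for a
    using eq[of "r (blinfun_apply \<pi> a)" a] by (simp add: bounded_linear_Blinfun_apply r)
  then show thesis using that by blast
qed

lemma functional_eq_sum_normals:
  fixes \<pi> :: "(real^'d::finite) \<Rightarrow>\<^sub>L 'n::real_normed_vector"
  shows "blinfun_apply x (blinfun_apply \<pi> a) = (\<Sum>i\<in>UNIV. a $ i * blinfun_apply x (normal \<pi> i))"
proof -
  have "blinfun_apply x (blinfun_apply \<pi> a) =
    blinfun_apply x (blinfun_apply \<pi> (\<Sum>i\<in>UNIV. a $ i *\<^sub>R axis i 1))"
    using basis_expansion[of a] by (simp add: scalar_mult_eq_scaleR)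
  then show ?thesis by (simp add: normal_def blinfun.sum_right blinfun.scaleR_right)
qed

text \<open>Pairing a point of the polyhedron with the relation gives a sum of nonnegative terms of constant
  total \<open>C\<close>, so each term is at most \<open>C\<close>. This bounds the values of the functional on all normals,
  and these span.\<close>
lemma positive_relation_imp_bounded_polyhedron:
  fixes \<pi> :: "(real^'d::finite) \<Rightarrow>\<^sub>L 'n::real_normed_vector"
  assumes surj: "surj (blinfun_apply \<pi>)" and s: "blinfun_apply \<pi> s = 0"
    and pos: "\<And>i. of_int (\<epsilon> i) * s $ i > 0"
  shows "bounded (polyhedron \<pi> lam \<epsilon>)"
proof -
  obtain K where K: "K > 0" "\<And>v. \<exists>a. blinfun_apply \<pi> a = v \<and> norm a \<le> K * norm v"
    using blinfun_surj_bounded_preimage[OF surj] by blast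
  define C where "C = (\<Sum>i\<in>UNIV. s $ i * lam $ i)"
  define L where "L i = C / \<bar>s $ i\<bar> + \<bar>lam $ i\<bar>" for i
  have "norm x \<le> K * (\<Sum>i\<in>UNIV. L i)" if x: "x \<in> polyhedron \<pi> lam \<epsilon>" for x
  proof -
    define c where "c i = blinfun_apply x (normal \<pi> i) + lam $ i" for i
    have "(\<Sum>i\<in>UNIV. s $ i * c i) = blinfun_apply x (blinfun_apply \<pi> s) + C"
      by (simp add: functional_eq_sum_normals c_def C_def distrib_left sum.distrib)
    then have sum: "(\<Sum>i\<in>UNIV. s $ i * c i) = C" by (simp add: s)
    have nonneg: "s $ i * c i \<ge> 0" for i
    proof -
      have "of_int (\<epsilon> i) * c i \<ge> 0" using x by (simp add: polyhedron_def c_def)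
      with pos[of i] show ?thesis by (auto simp: zero_less_mult_iff zero_le_mult_iff)
    qed
    have bd: "\<bar>blinfun_apply x (normal \<pi> i)\<bar> \<le> L i" for i
    proof -
      have "s $ i * c i \<le> (\<Sum>i\<in>UNIV. s $ i * c i)" by (rule member_le_sum) (auto simp: nonneg)
      then have "\<bar>s $ i\<bar> * \<bar>c i\<bar> \<le> C" using nonneg[of i] sum by (simp flip: abs_mult)
      moreover have "s $ i \<noteq> 0" using pos[of i] by auto
      ultimately have "\<bar>c i\<bar> \<le> C / \<bar>s $ i\<bar>" by (simp add: pos_le_divide_eq mult.commute)
      then show ?thesis unfolding L_def c_def by linarith
    qed
    have Lsum: "0 \<le> (\<Sum>i\<in>UNIV. L i)" using bd by (intro sum_nonneg) (meson abs_ge_zero order_trans)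
    show ?thesis
    proof (rule norm_blinfun_bound)
      show "0 \<le> K * (\<Sum>i\<in>UNIV. L i)" using K(1) Lsum by simp
      fix v
      obtain a where a: "blinfun_apply \<pi> a = v" "norm a \<le> K * norm v" using K(2) by blast
      have "norm (blinfun_apply x v) \<le> (\<Sum>i\<in>UNIV. \<bar>a $ i * blinfun_apply x (normal \<pi> i)\<bar>)"
        unfolding a(1)[symmetric] functional_eq_sum_normals real_norm_def by (rule sum_abs)
      also have "\<dots> \<le> (\<Sum>i\<in>UNIV. norm a * L i)"
        by (intro sum_mono) (auto simp: abs_mult intro!: mult_mono component_le_norm_cart bd)
      also have "\<dots> = norm a * (\<Sum>i\<in>UNIV. L i)" by (simp add: sum_distrib_left)
      also have "\<dots> \<le> K * norm v * (\<Sum>i\<in>UNIV. L i)" by (intro mult_right_mono a Lsum)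
      finally show "norm (blinfun_apply x v) \<le> K * (\<Sum>i\<in>UNIV. L i) * norm v" by (simp add: mult_ac)
    qed
  qed
  then show ?thesis by (intro boundedI)
qed

text \<open>If all relations vanished in coordinate \<open>i\<close>, the \<open>i\<close>-th coordinate functional would
  descend to the quotient. It is zero on all normals but the \<open>i\<close>-th, so a ray in its direction, with the
  sign \<open>\<epsilon> i\<close>, would stay inside the polyhedron.\<close>
lemma bounded_polyhedron_imp_relations_nonzero:
  fixes \<pi> :: "(real^'d::finite) \<Rightarrow>\<^sub>L 'n::real_normed_vector"
  assumes surj: "surj (blinfun_apply \<pi>)" and \<epsilon>: "\<epsilon> \<in> Theta"
    and bdd: "bounded (polyhedron \<pi> lam \<epsilon>)" and x: "x \<in> polyhedron \<pi> lam \<epsilon>"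
  shows "\<exists>s. blinfun_apply \<pi> s = 0 \<and> s $ i \<noteq> 0"
proof (rule ccontr)
  assume "\<not> ?thesis"
  then have "axis i 1 \<bullet> a = 0" if "blinfun_apply \<pi> a = 0" for a
    using that by (auto simp: inner_axis')
  then obtain y :: "'n \<Rightarrow>\<^sub>L real" where y: "\<And>a. blinfun_apply y (blinfun_apply \<pi> a) = axis i 1 \<bullet> a"
    using functional_factors_through_quotient[OF surj] by blast
  have yn: "blinfun_apply y (normal \<pi> j) = (if j = i then 1 else 0)" for j
    by (simp add: normal_def y inner_axis') (auto simp: axis_def)
  have mem: "x + (t * of_int (\<epsilon> i)) *\<^sub>R y \<in> polyhedron \<pi> lam \<epsilon>" if "t \<ge> 0" for t
  proof -
    have "of_int (\<epsilon> i) * (of_int (\<epsilon> i) :: real) = 1" using \<epsilon> by (auto simp: Theta_def dest: spec[of _ i])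
    then have sq: "of_int (\<epsilon> i) * (t * of_int (\<epsilon> i)) = t" by (metis mult.left_commute mult.right_neutral)
    show ?thesis unfolding polyhedron_def
    proof safe
      fix j
      have "of_int (\<epsilon> j) * (blinfun_apply x (normal \<pi> j) + lam $ j) \<ge> 0"
        using x by (simp add: polyhedron_def)
      moreover have "of_int (\<epsilon> j) * (t * of_int (\<epsilon> i) * blinfun_apply y (normal \<pi> j)) \<ge> 0"
      proof (cases "j = i")
        case True
        then have "blinfun_apply y (normal \<pi> j) = 1" by (simp add: yn)
        with True show ?thesis using that sq by (simp only: mult_1_right)
      qed (simp add: yn)
      ultimately show "0 \<le> of_int (\<epsilon> j) *
          (blinfun_apply (x + (t * of_int (\<epsilon> i)) *\<^sub>R y) (normal \<pi> j) + lam $ j)"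
        by (simp add: blinfun.add_left blinfun.scaleR_left distrib_left)
    qed
  qed
  obtain D where D: "\<And>z. z \<in> polyhedron \<pi> lam \<epsilon> \<Longrightarrow> norm z \<le> D" using bdd by (auto simp: bounded_iff)
  have D0: "D \<ge> 0" using D[OF x] norm_ge_zero order_trans by blast
  have ny: "norm y > 0" using yn[of i] by auto
  \<comment> \<open>Two points of norm at most D have distance at most 2 D, so this step along the ray is too long.\<close>
  define t where "t = (2 * D + 1) / norm y"
  have t: "t \<ge> 0" using D0 by (simp add: t_def)
  have "\<bar>of_int (\<epsilon> i) :: real\<bar> = 1" using \<epsilon> by (auto simp: Theta_def dest: spec[of _ i])
  then have "norm ((t * of_int (\<epsilon> i)) *\<^sub>R y) = 2 * D + 1" using t ny D0 by (simp add: abs_mult t_def)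
  moreover have "norm ((t * of_int (\<epsilon> i)) *\<^sub>R y) \<le> norm (x + (t * of_int (\<epsilon> i)) *\<^sub>R y) + norm x"
    using norm_triangle_ineq4[of "x + (t * of_int (\<epsilon> i)) *\<^sub>R y" x] by simp
  ultimately show False using D[OF x] D[OF mem[OF t]] by linarith
qed

section \<open>Semi-stability in terms of sign vectors\<close>

definition pullback :: "('m::real_normed_vector \<Rightarrow>\<^sub>L (real^'d::finite)) \<Rightarrow> real^'d \<Rightarrow> 'm \<Rightarrow>\<^sub>L real" where
  "pullback \<iota> c = (\<Sum>i\<in>UNIV. (c $ i) *\<^sub>R iota_star \<iota> (dual_basis i))"

lemma pullback_apply: "blinfun_apply (pullback \<iota> c) v = c \<bullet> blinfun_apply \<iota> v"
proof -
  have "blinfun_apply (iota_star \<iota> (dual_basis i)) v = blinfun_apply \<iota> v $ i" for i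
    by (simp add: iota_star_def dual_basis_def inner_axis)
  then have "blinfun_apply (pullback \<iota> c) v = (\<Sum>i\<in>UNIV. c $ i * blinfun_apply \<iota> v $ i)"
    by (simp add: pullback_def blinfun.sum_left blinfun.scaleR_left)
  then show ?thesis by (simp add: inner_vec_def)
qed

lemma pullback_eq_iff:
  "pullback \<iota> c = pullback \<iota> c' \<longleftrightarrow> (\<forall>s\<in>range (blinfun_apply \<iota>). (c - c') \<bullet> s = 0)"
proof -
  have "pullback \<iota> c = pullback \<iota> c' \<longleftrightarrow>
      (\<forall>v. blinfun_apply (pullback \<iota> c) v = blinfun_apply (pullback \<iota> c') v)"
    by (metis blinfun_eqI)
  then show ?thesis by (simp add: pullback_apply inner_diff_left)
qed

text \<open>The two nonnegative combinations merge into one vector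
  \<open>c\<^sub>i = a\<^sub>i |z\<^sub>i|\<^sup>2 - b\<^sub>i |w\<^sub>i|\<^sup>2\<close>. Conversely its positive and negative parts recover the coefficients, by
  division by the squared norms, which do not vanish where the part in question is nonzero.\<close>
lemma semistable_iff:
  "semistable \<iota> \<alpha> p \<longleftrightarrow>
    (\<exists>c. \<alpha> = pullback \<iota> c \<and> (\<forall>i. (c $ i > 0 \<longrightarrow> fst p $ i \<noteq> 0) \<and> (c $ i < 0 \<longrightarrow> snd p $ i \<noteq> 0)))"
    (is "_ \<longleftrightarrow> ?R")
proof -
  have comb: "(\<Sum>i\<in>UNIV. (a i * (norm (fst p $ i))\<^sup>2) *\<^sub>R iota_star \<iota> (dual_basis i)) +
         (\<Sum>i\<in>UNIV. (b i * (norm (snd p $ i))\<^sup>2) *\<^sub>R (- iota_star \<iota> (dual_basis i))) =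
      pullback \<iota> (\<chi> i. a i * (norm (fst p $ i))\<^sup>2 - b i * (norm (snd p $ i))\<^sup>2)" for a b
    by (simp add: pullback_def scaleR_left_diff_distrib sum_subtractf sum_negf)
  show ?thesis
  proof
    assume "semistable \<iota> \<alpha> p"
    then obtain a b where ab: "\<And>i. 0 \<le> a i \<and> 0 \<le> b i"
      "\<alpha> = pullback \<iota> (\<chi> i. a i * (norm (fst p $ i))\<^sup>2 - b i * (norm (snd p $ i))\<^sup>2)"
      unfolding semistable_def comb by blast
    show ?R
    proof (intro exI conjI allI impI)
      fix i
      have *: "0 \<le> a i * (norm (fst p $ i))\<^sup>2" "0 \<le> b i * (norm (snd p $ i))\<^sup>2" using ab(1) by auto
      show "fst p $ i \<noteq> 0" if "(\<chi> i. a i * (norm (fst p $ i))\<^sup>2 - b i * (norm (snd p $ i))\<^sup>2) $ i > 0"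
        using that * by auto
      show "snd p $ i \<noteq> 0" if "(\<chi> i. a i * (norm (fst p $ i))\<^sup>2 - b i * (norm (snd p $ i))\<^sup>2) $ i < 0"
        using that * by auto
    qed (rule ab(2))
  next
    assume ?R
    then obtain c where c: "\<alpha> = pullback \<iota> c"
      "\<And>i. c $ i > 0 \<Longrightarrow> fst p $ i \<noteq> 0" "\<And>i. c $ i < 0 \<Longrightarrow> snd p $ i \<noteq> 0" by blast
    define a where "a i = max (c $ i) 0 / (norm (fst p $ i))\<^sup>2" for i
    define b where "b i = max (- c $ i) 0 / (norm (snd p $ i))\<^sup>2" for i
    have "a i * (norm (fst p $ i))\<^sup>2 - b i * (norm (snd p $ i))\<^sup>2 = c $ i" for i
      using c(2,3)[of i] by (cases "c $ i" "0::real" rule: linorder_cases) (auto simp: a_def b_def)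
    then have "\<alpha> = pullback \<iota> (\<chi> i. a i * (norm (fst p $ i))\<^sup>2 - b i * (norm (snd p $ i))\<^sup>2)"
      using c(1) by simp
    moreover have "\<forall>i. 0 \<le> a i \<and> 0 \<le> b i" by (simp add: a_def b_def)
    ultimately show "semistable \<iota> \<alpha> p" unfolding semistable_def comb by blast
  qed
qed

text \<open>Here only one of the two generators with index \<open>i\<close> is present, so the sign of \<open>c\<^sub>i\<close> is
  prescribed: \<open>c\<close> is a point of the chamber of \<open>\<epsilon>\<close>.\<close>
lemma eps_semistable_iff:
  assumes \<epsilon>: "\<epsilon> \<in> Theta"
  shows "v \<in> eps_semistable \<iota> \<alpha> \<epsilon> \<longleftrightarrow>
    (\<exists>c. \<alpha> = pullback \<iota> c \<and> (\<forall>i. of_int (\<epsilon> i) * c $ i \<ge> 0 \<and> (c $ i \<noteq> 0 \<longrightarrow> v $ i \<noteq> 0)))"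
    (is "_ \<longleftrightarrow> ?R")
proof -
  have \<epsilon>i: "\<epsilon> i = 1 \<or> \<epsilon> i = -1" for i using \<epsilon> by (auto simp: Theta_def)
  have comb: "(\<Sum>i | \<epsilon> i = 1. (a i * (norm (v $ i))\<^sup>2) *\<^sub>R iota_star \<iota> (dual_basis i)) +
         (\<Sum>i | \<epsilon> i \<noteq> 1. (a i * (norm (v $ i))\<^sup>2) *\<^sub>R (- iota_star \<iota> (dual_basis i))) =
      pullback \<iota> (\<chi> i. of_int (\<epsilon> i) * (a i * (norm (v $ i))\<^sup>2))" (is "?A + ?B = _") for a
  proof -
    let ?f = "\<lambda>i. (of_int (\<epsilon> i) * (a i * (norm (v $ i))\<^sup>2)) *\<^sub>R iota_star \<iota> (dual_basis i)"
    have "?A = sum ?f {i. \<epsilon> i = 1}" by (intro sum.cong) auto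
    moreover have "?B = sum ?f {i. \<epsilon> i \<noteq> 1}" using \<epsilon>i by (intro sum.cong) force+
    moreover have "sum ?f UNIV = sum ?f {i. \<epsilon> i = 1} + sum ?f {i. \<epsilon> i \<noteq> 1}"
      by (subst sum.union_disjoint[symmetric]) (auto intro: sum.cong)
    ultimately show ?thesis by (simp add: pullback_def)
  qed
  show ?thesis
  proof
    assume "v \<in> eps_semistable \<iota> \<alpha> \<epsilon>"
    then obtain a where a: "\<And>i. 0 \<le> a i"
      "\<alpha> = pullback \<iota> (\<chi> i. of_int (\<epsilon> i) * (a i * (norm (v $ i))\<^sup>2))"
      unfolding eps_semistable_def mem_Collect_eq comb by blast
    show ?R
    proof (intro exI conjI allI impI)
      fix i
      show "of_int (\<epsilon> i) * (\<chi> i. of_int (\<epsilon> i) * (a i * (norm (v $ i))\<^sup>2)) $ i \<ge> 0"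
        using a(1)[of i] \<epsilon>i[of i] by auto
      show "v $ i \<noteq> 0" if "(\<chi> i. of_int (\<epsilon> i) * (a i * (norm (v $ i))\<^sup>2)) $ i \<noteq> 0"
        using that by auto
    qed (rule a(2))
  next
    assume ?R
    then obtain c where c: "\<alpha> = pullback \<iota> c" "\<And>i. of_int (\<epsilon> i) * c $ i \<ge> 0"
      "\<And>i. c $ i \<noteq> 0 \<Longrightarrow> v $ i \<noteq> 0" by blast
    define a where "a i = \<bar>c $ i\<bar> / (norm (v $ i))\<^sup>2" for i
    have "of_int (\<epsilon> i) * (a i * (norm (v $ i))\<^sup>2) = c $ i" for i
    proof (cases "c $ i = 0")
      case False
      with c(3) have "a i * (norm (v $ i))\<^sup>2 = \<bar>c $ i\<bar>" by (simp add: a_def)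
      then show ?thesis using c(2)[of i] \<epsilon>i[of i] by auto
    qed (simp add: a_def)
    then have "\<alpha> = pullback \<iota> (\<chi> i. of_int (\<epsilon> i) * (a i * (norm (v $ i))\<^sup>2))" using c(1) by simp
    moreover have "\<forall>i. 0 \<le> a i" by (simp add: a_def)
    ultimately show "v \<in> eps_semistable \<iota> \<alpha> \<epsilon>" unfolding eps_semistable_def mem_Collect_eq comb by blast
  qed
qed

lemma eps_semistable_imp_semistable:
  assumes \<epsilon>: "\<epsilon> \<in> Theta" and ss: "eps_coords \<epsilon> p \<in> eps_semistable \<iota> \<alpha> \<epsilon>"
  shows "semistable \<iota> \<alpha> p"
proof -
  obtain c where c: "\<alpha> = pullback \<iota> c" "\<And>i. of_int (\<epsilon> i) * c $ i \<ge> 0"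
    "\<And>i. c $ i \<noteq> 0 \<Longrightarrow> eps_coords \<epsilon> p $ i \<noteq> 0"
    using ss unfolding eps_semistable_iff[OF \<epsilon>] by blast
  have \<epsilon>i: "\<epsilon> i = 1 \<or> \<epsilon> i = -1" for i using \<epsilon> by (auto simp: Theta_def)
  have "(c $ i > 0 \<longrightarrow> fst p $ i \<noteq> 0) \<and> (c $ i < 0 \<longrightarrow> snd p $ i \<noteq> 0)" for i
    using c(2,3)[of i] \<epsilon>i[of i] by (auto simp: eps_coords_def)
  with c(1) show ?thesis unfolding semistable_iff by blast
qed

text \<open>The covering at the level of points. The vertex \<open>c\<close> replacing the witness \<open>c0\<close> has
  no sign that \<open>c0\<close> lacks, so the coordinates that must be nonzero for \<open>c\<close> are so already.\<close>
lemma semistable_imp_eps_semistable: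
  fixes \<iota> :: "'m::real_normed_vector \<Rightarrow>\<^sub>L (real^'d::finite)"
    and \<pi> :: "(real^'d) \<Rightarrow>\<^sub>L 'n::real_normed_vector"
  assumes surj: "surj (blinfun_apply \<pi>)"
    and ker: "{v. blinfun_apply \<pi> v = 0} = range (blinfun_apply \<iota>)"
    and nz: "\<And>i. \<exists>s. blinfun_apply \<pi> s = 0 \<and> s $ i \<noteq> 0"
    and ss: "semistable \<iota> \<alpha> p"
  shows "\<exists>\<epsilon>\<in>Theta_cpt \<pi> lam. eps_coords \<epsilon> p \<in> eps_semistable \<iota> \<alpha> \<epsilon>"
proof -
  obtain c0 where c0: "\<alpha> = pullback \<iota> c0"
    "\<And>i. c0 $ i > 0 \<Longrightarrow> fst p $ i \<noteq> 0" "\<And>i. c0 $ i < 0 \<Longrightarrow> snd p $ i \<noteq> 0"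
    using ss unfolding semistable_iff by blast
  define S where "S = {v. blinfun_apply \<pi> v = 0}"
  have S: "subspace S" by (simp add: S_def subspace_def blinfun.add_right blinfun.scaleR_right)
  have "\<exists>s\<in>S. s $ i \<noteq> 0" for i using nz by (simp add: S_def)
  with S obtain c \<epsilon> s where c: "\<And>v. v \<in> S \<Longrightarrow> (c - c0) \<bullet> v = 0"
    "\<And>i. c $ i > 0 \<Longrightarrow> c0 $ i > 0" "\<And>i. c $ i < 0 \<Longrightarrow> c0 $ i < 0"
    and \<epsilon>: "\<epsilon> \<in> Theta" "\<And>i. of_int (\<epsilon> i) * c $ i \<ge> 0"
    and s: "s \<in> S" "\<And>i. of_int (\<epsilon> i) * s $ i > 0"
    using exists_conformal_positive_relation[of S c0] by metis
  have "bounded (polyhedron \<pi> lam \<epsilon>)"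
    using positive_relation_imp_bounded_polyhedron[OF surj, of s] s by (simp add: S_def)
  then have "\<epsilon> \<in> Theta_cpt \<pi> lam" using \<epsilon>(1) by (simp add: Theta_cpt_def)
  moreover have "pullback \<iota> c = \<alpha>"
    unfolding c0(1) pullback_eq_iff using c(1) unfolding S_def ker by blast
  moreover have "c $ i \<noteq> 0 \<longrightarrow> eps_coords \<epsilon> p $ i \<noteq> 0" for i
  proof -
    have "\<epsilon> i = 1 \<or> \<epsilon> i = -1" using \<epsilon>(1) by (auto simp: Theta_def)
    then show ?thesis
      using c(2,3)[of i] c0(2,3)[of i] \<epsilon>(2)[of i] by (auto simp: eps_coords_def neq_iff)
  qed
  ultimately show ?thesis using \<epsilon>
    by (intro bexI[of _ \<epsilon>]) (auto simp: eps_semistable_iff)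
qed

text \<open>The real moment map equation is itself a semi-stability witness, with all coefficients equal
  to one half.\<close>
lemma level_set_semistable:
  assumes "p \<in> level_set \<iota> \<alpha>"
  shows "\<alpha> = pullback \<iota> (\<chi> i. ((norm (fst p $ i))\<^sup>2 - (norm (snd p $ i))\<^sup>2) / 2)"
    and "p \<in> semistable_set \<iota> \<alpha>"
proof -
  have \<alpha>: "mu_R \<iota> p = \<alpha>" and C: "mu_C \<iota> p = 0" using assms by (auto simp: level_set_def mu_def)
  show eq: "\<alpha> = pullback \<iota> (\<chi> i. ((norm (fst p $ i))\<^sup>2 - (norm (snd p $ i))\<^sup>2) / 2)"
    unfolding \<alpha>[symmetric] mu_R_def pullback_def by (simp add: scaleR_sum_right)
  have "semistable \<iota> \<alpha> p"
    unfolding semistable_iff by (rule exI, rule conjI, rule eq) auto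
  with C show "p \<in> semistable_set \<iota> \<alpha>" by (simp add: semistable_set_def)
qed

text \<open>A point of the core component of \<open>\<epsilon>\<close> yields, through the real moment map, a point of the
  polyhedron of \<open>\<epsilon>\<close>, which is thus nonempty as well as bounded.\<close>
lemma core_nonempty_imp_relations_nonzero:
  fixes \<iota> :: "'m::real_normed_vector \<Rightarrow>\<^sub>L (real^'d::finite)"
    and \<pi> :: "(real^'d) \<Rightarrow>\<^sub>L 'n::real_normed_vector"
  assumes surj: "surj (blinfun_apply \<pi>)"
    and ker: "{v. blinfun_apply \<pi> v = 0} = range (blinfun_apply \<iota>)"
    and \<alpha>: "\<alpha> = pullback \<iota> lam"
    and core: "core M \<iota> \<pi> \<alpha> lam \<noteq> {}"
  shows "\<exists>s. blinfun_apply \<pi> s = 0 \<and> s $ i \<noteq> 0"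
proof -
  obtain \<epsilon> p where \<epsilon>: "\<epsilon> \<in> Theta" "bounded (polyhedron \<pi> lam \<epsilon>)" and p: "p \<in> level_set \<iota> \<alpha>"
    and van: "\<And>i. (\<epsilon> i = 1 \<longrightarrow> snd p $ i = 0) \<and> (\<epsilon> i = -1 \<longrightarrow> fst p $ i = 0)"
    using core by (auto simp: core_def Z_comp_def orbit_space_def Theta_cpt_def)
  define c where "c = (\<chi> i. ((norm (fst p $ i))\<^sup>2 - (norm (snd p $ i))\<^sup>2) / 2)"
  have "pullback \<iota> c = pullback \<iota> lam" using level_set_semistable(1)[OF p] \<alpha> by (simp add: c_def)
  then have "(c - lam) \<bullet> a = 0" if "blinfun_apply \<pi> a = 0" for a
    using that ker unfolding pullback_eq_iff by blast
  then obtain x where x: "\<And>a. blinfun_apply x (blinfun_apply \<pi> a) = (c - lam) \<bullet> a"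
    using functional_factors_through_quotient[OF surj] by blast
  have "blinfun_apply x (normal \<pi> j) + lam $ j = c $ j" for j
    by (simp add: normal_def x inner_axis)
  moreover have "of_int (\<epsilon> j) * c $ j \<ge> 0" for j
  proof -
    have "\<epsilon> j = 1 \<or> \<epsilon> j = -1" using \<epsilon>(1) by (auto simp: Theta_def)
    then show ?thesis using van[of j] by (auto simp: c_def)
  qed
  ultimately have "x \<in> polyhedron \<pi> lam \<epsilon>" by (simp add: polyhedron_def)
  with \<epsilon> show ?thesis by (intro bounded_polyhedron_imp_relations_nonzero[OF surj])
qed

section \<open>Invariance and openness\<close>

definition eps_stable_points ::
  "('m::real_normed_vector \<Rightarrow>\<^sub>L (real^'d)) \<Rightarrow> ('m \<Rightarrow>\<^sub>L real) \<Rightarrow> ('d::finite \<Rightarrow> int) \<Rightarrow> 'd quat set" where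
  "eps_stable_points \<iota> \<alpha> \<epsilon> = {p. mu_C \<iota> p = 0 \<and> eps_coords \<epsilon> p \<in> eps_semistable \<iota> \<alpha> \<epsilon>}"

text \<open>The same witness \<open>c\<close> serves for both vectors. Both the openness and the invariance of the
  canonical sets rest on this monotonicity.\<close>
lemma eps_semistable_mono:
  assumes "\<epsilon> \<in> Theta" "v \<in> eps_semistable \<iota> \<alpha> \<epsilon>" "\<And>i. v $ i \<noteq> 0 \<Longrightarrow> v' $ i \<noteq> 0"
  shows "v' \<in> eps_semistable \<iota> \<alpha> \<epsilon>"
  using assms unfolding eps_semistable_iff[OF assms(1)] by metis

lemma mu_C_act:
  assumes "\<And>i. t $ i \<noteq> 0"
  shows "mu_C \<iota> (act t p) = mu_C \<iota> p"
proof -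
  have "t $ i * z * (w * inverse (t $ i)) = z * w" for i z w
    using assms[of i] by (simp add: field_simps)
  then show ?thesis unfolding mu_C_def act_def by (simp only: fst_conv snd_conv vec_lambda_beta)
qed

lemma act_eps_stable_points_iff:
  assumes \<epsilon>: "\<epsilon> \<in> Theta" and t: "\<And>i. t $ i \<noteq> 0"
  shows "act t p \<in> eps_stable_points \<iota> \<alpha> \<epsilon> \<longleftrightarrow> p \<in> eps_stable_points \<iota> \<alpha> \<epsilon>"
proof -
  have "eps_coords \<epsilon> (act t p) $ i \<noteq> 0 \<longleftrightarrow> eps_coords \<epsilon> p $ i \<noteq> 0" for i
    using t by (auto simp: eps_coords_def act_def)
  then show ?thesis
    using eps_semistable_mono[OF \<epsilon>] mu_C_act[OF t, of \<iota> p]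
    unfolding eps_stable_points_def mem_Collect_eq by metis
qed

text \<open>Coordinates that are nonzero at a point remain nonzero nearby; by monotonicity any witness survives.\<close>
lemma open_eps_semistable_points:
  fixes \<epsilon> :: "'d::finite \<Rightarrow> int"
  assumes \<epsilon>: "\<epsilon> \<in> Theta"
  shows "open {p. eps_coords \<epsilon> p \<in> eps_semistable \<iota> \<alpha> \<epsilon>}"
proof (subst open_subopen, intro ballI)
  fix p assume "p \<in> {p. eps_coords \<epsilon> p \<in> eps_semistable \<iota> \<alpha> \<epsilon>}"
  then have p: "eps_coords \<epsilon> p \<in> eps_semistable \<iota> \<alpha> \<epsilon>" by simp
  define T where "T = (\<Inter>i\<in>{i. eps_coords \<epsilon> p $ i \<noteq> 0}. {q. eps_coords \<epsilon> q $ i \<noteq> 0})"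
  have "continuous_on UNIV (\<lambda>q. eps_coords \<epsilon> q $ i)" for i
    by (cases "\<epsilon> i = 1") (auto simp: eps_coords_def intro!: continuous_intros)
  then have "open {q. eps_coords \<epsilon> q $ i \<noteq> 0}" for i
    by (intro open_Collect_neq continuous_on_const)
  then have "open T" unfolding T_def by (intro open_INT) auto
  moreover have "p \<in> T" by (simp add: T_def)
  moreover have "T \<subseteq> {p. eps_coords \<epsilon> p \<in> eps_semistable \<iota> \<alpha> \<epsilon>}"
    using eps_semistable_mono[OF \<epsilon> p] by (auto simp: T_def)
  ultimately show "\<exists>T. open T \<and> p \<in> T \<and> T \<subseteq> {p. eps_coords \<epsilon> p \<in> eps_semistable \<iota> \<alpha> \<epsilon>}" by blast
qed

lemma self_in_orbit:
  assumes "1 \<in> G"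
  shows "p \<in> orbit G p"
proof -
  have "act 1 p = p" by (simp add: act_def prod_eq_iff vec_eq_iff)
  with assms show ?thesis unfolding orbit_def by (metis imageI)
qed

lemma act_level_set:
  assumes t: "t \<in> real_torus" and p: "p \<in> level_set \<iota> \<alpha>"
  shows "act t p \<in> level_set \<iota> \<alpha>"
proof -
  have n: "norm (t $ i) = 1" for i using t by (simp add: real_torus_def)
  then have "t $ i \<noteq> 0" for i by (metis norm_zero zero_neq_one)
  then have "mu_C \<iota> (act t p) = mu_C \<iota> p" by (rule mu_C_act)
  moreover have "mu_R \<iota> (act t p) = mu_R \<iota> p"
    using n by (simp add: mu_R_def act_def norm_mult norm_inverse)
  ultimately show ?thesis using p by (simp add: level_set_def mu_def)
qed

lemma complexification_nonzero: "t \<in> complexification M \<Longrightarrow> t $ i \<noteq> 0"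
  by (auto simp: complexification_def torus_exp_def)

lemma one_in_complexification:
  assumes "0 \<in> lie_algebra M"
  shows "1 \<in> complexification M"
proof -
  have "1 = torus_exp (\<chi> i. Complex ((0::real^'a) $ i) ((0::real^'a) $ i))"
    by (simp add: torus_exp_def vec_eq_iff flip: zero_complex.code)
  with assms show ?thesis unfolding complexification_def by blast
qed

lemma Union_U_GIT:
  assumes \<epsilon>: "\<epsilon> \<in> Theta" and one: "1 \<in> complexification M"
  shows "\<Union> (U_GIT M \<iota> \<alpha> \<epsilon>) = eps_stable_points \<iota> \<alpha> \<epsilon>"
proof -
  have U: "U_GIT M \<iota> \<alpha> \<epsilon> = orbit (complexification M) ` eps_stable_points \<iota> \<alpha> \<epsilon>"
    by (simp add: U_GIT_def orbit_space_def eps_stable_points_def)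
  note self = self_in_orbit[OF one]
  then show ?thesis unfolding U
    using act_eps_stable_points_iff[OF \<epsilon> complexification_nonzero]
      self by (fastforce simp: orbit_def)
qed

lemma orbit_in_U_GIT_iff:
  assumes \<epsilon>: "\<epsilon> \<in> Theta" and one: "1 \<in> complexification M"
  shows "orbit (complexification M) p \<in> U_GIT M \<iota> \<alpha> \<epsilon> \<longleftrightarrow> p \<in> eps_stable_points \<iota> \<alpha> \<epsilon>"
proof
  show "p \<in> eps_stable_points \<iota> \<alpha> \<epsilon>" if "orbit (complexification M) p \<in> U_GIT M \<iota> \<alpha> \<epsilon>"
    using that Union_U_GIT[OF assms] self_in_orbit[OF one] by blast
qed (auto simp: U_GIT_def orbit_space_def eps_stable_points_def)

text \<open>A set of orbits is open in the quotient iff the union of its members is open upstairs. That union is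
  cut out of the level set by the stability condition because the condition is constant on orbits.\<close>
lemma Union_U:
  assumes \<epsilon>: "\<epsilon> \<in> Theta" and one: "1 \<in> complexification M"
    and M: "M \<subseteq> real_torus" "1 \<in> M"
  shows "\<Union> (U M \<iota> \<alpha> \<epsilon>) = level_set \<iota> \<alpha> \<inter> eps_stable_points \<iota> \<alpha> \<epsilon>"
proof -
  have nz: "t $ i \<noteq> 0" if "t \<in> M" for t i
  proof -
    have "norm (t $ i) = 1" using M(1) that by (auto simp: real_torus_def)
    then show ?thesis by (metis norm_zero zero_neq_one)
  qed
  have stab: "q \<in> eps_stable_points \<iota> \<alpha> \<epsilon> \<longleftrightarrow> p \<in> eps_stable_points \<iota> \<alpha> \<epsilon>" if "q \<in> orbit M p" for p q
    using that act_eps_stable_points_iff[OF \<epsilon> nz, of _ p] unfolding orbit_def by blast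
  note self = self_in_orbit[OF M(2)]
  have U: "U M \<iota> \<alpha> \<epsilon> = {orbit M p | p. p \<in> level_set \<iota> \<alpha> \<and> p \<in> eps_stable_points \<iota> \<alpha> \<epsilon>}"
    unfolding U_def Y_def orbit_space_def orbit_in_U_GIT_iff[OF \<epsilon> one] using stab self by blast
  have "orbit M p \<subseteq> level_set \<iota> \<alpha>" if "p \<in> level_set \<iota> \<alpha>" for p
    using that M(1) act_level_set[of _ p] unfolding orbit_def by blast
  then have "orbit M p \<subseteq> level_set \<iota> \<alpha> \<inter> eps_stable_points \<iota> \<alpha> \<epsilon>"
    if "p \<in> level_set \<iota> \<alpha>" "p \<in> eps_stable_points \<iota> \<alpha> \<epsilon>" for p
    using that stab[of _ p] by blast
  then show ?thesis unfolding U using self by blast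
qed

section \<open>The covering\<close>

theorem theorem1p3:
  fixes M :: "(complex^'d::finite) set"
    and \<iota> :: "'m::real_normed_vector \<Rightarrow>\<^sub>L (real^'d)"
    and \<pi> :: "(real^'d) \<Rightarrow>\<^sub>L 'n::real_normed_vector"
    and \<alpha> :: "'m \<Rightarrow>\<^sub>L real"
    and lam :: "real^'d"
  assumes "subtorus M"
    and "exact_seq M \<iota> \<pi>"
    and "\<And>i. primitive_in (quotient_lattice \<pi>) (normal \<pi> i)"
    and "\<alpha> = (\<Sum>i\<in>UNIV. (lam $ i) *\<^sub>R iota_star \<iota> (dual_basis i))"
    and "smooth \<iota> \<pi> \<alpha>"
    and "core M \<iota> \<pi> \<alpha> lam \<noteq> {}"
  shows "Y M \<iota> \<alpha> = (\<Union>\<epsilon>\<in>Theta_cpt \<pi> lam. U M \<iota> \<alpha> \<epsilon>) \<and>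
    (\<forall>\<epsilon>\<in>Theta_cpt \<pi> lam. open_in_quotient (level_set \<iota> \<alpha>) (U M \<iota> \<alpha> \<epsilon>)) \<and>
    Y_GIT M \<iota> \<alpha> = (\<Union>\<epsilon>\<in>Theta_cpt \<pi> lam. U_GIT M \<iota> \<alpha> \<epsilon>) \<and>
    (\<forall>\<epsilon>\<in>Theta_cpt \<pi> lam. open_in_quotient (semistable_set \<iota> \<alpha>) (U_GIT M \<iota> \<alpha> \<epsilon>))"
proof -
  have M: "M \<subseteq> real_torus" "1 \<in> M" using assms(1) by (auto simp: subtorus_def)
  have surj: "surj (blinfun_apply \<pi>)" and ker: "{v. blinfun_apply \<pi> v = 0} = range (blinfun_apply \<iota>)"
    and lie: "range (blinfun_apply \<iota>) = lie_algebra M"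
    using assms(2) by (auto simp: exact_seq_def)
  have "0 \<in> lie_algebra M" unfolding lie[symmetric] by (metis blinfun.zero_right rangeI)
  then have one: "1 \<in> complexification M" by (rule one_in_complexification)
  have "\<exists>s. blinfun_apply \<pi> s = 0 \<and> s $ i \<noteq> 0" for i
    using core_nonempty_imp_relations_nonzero[OF surj ker _ assms(6)] assms(4)
    by (simp add: pullback_def)
  then have cover: "\<exists>\<epsilon>\<in>Theta_cpt \<pi> lam. p \<in> eps_stable_points \<iota> \<alpha> \<epsilon>"
    if "p \<in> semistable_set \<iota> \<alpha>" for p
    using semistable_imp_eps_semistable[OF surj ker] that
    by (simp add: semistable_set_def eps_stable_points_def)
  have Th: "\<epsilon> \<in> Theta" if "\<epsilon> \<in> Theta_cpt \<pi> lam" for \<epsilon> using that by (simp add: Theta_cpt_def)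
  have sub: "eps_stable_points \<iota> \<alpha> \<epsilon> \<subseteq> semistable_set \<iota> \<alpha>" if "\<epsilon> \<in> Theta" for \<epsilon>
    using eps_semistable_imp_semistable[OF that]
    by (auto simp: eps_stable_points_def semistable_set_def)
  have "Y M \<iota> \<alpha> \<subseteq> (\<Union>\<epsilon>\<in>Theta_cpt \<pi> lam. U M \<iota> \<alpha> \<epsilon>)"
  proof
    fix Q assume Q: "Q \<in> Y M \<iota> \<alpha>"
    then obtain p where p: "p \<in> level_set \<iota> \<alpha>" "Q = orbit M p" by (auto simp: Y_def orbit_space_def)
    have "p \<in> Q" using self_in_orbit[OF M(2)] p(2) by simp
    moreover obtain \<epsilon> where "\<epsilon> \<in> Theta_cpt \<pi> lam" "p \<in> eps_stable_points \<iota> \<alpha> \<epsilon>"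
      using cover level_set_semistable(2)[OF p(1)] by blast
    ultimately show "Q \<in> (\<Union>\<epsilon>\<in>Theta_cpt \<pi> lam. U M \<iota> \<alpha> \<epsilon>)"
      using Q orbit_in_U_GIT_iff[OF Th one, of _ p] unfolding U_def by blast
  qed
  then have 1: "Y M \<iota> \<alpha> = (\<Union>\<epsilon>\<in>Theta_cpt \<pi> lam. U M \<iota> \<alpha> \<epsilon>)" by (auto simp: U_def)
  have "semistable_set \<iota> \<alpha> = (\<Union>\<epsilon>\<in>Theta_cpt \<pi> lam. eps_stable_points \<iota> \<alpha> \<epsilon>)"
    using cover sub Th by blast
  then have 3: "Y_GIT M \<iota> \<alpha> = (\<Union>\<epsilon>\<in>Theta_cpt \<pi> lam. U_GIT M \<iota> \<alpha> \<epsilon>)"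
    by (simp add: Y_GIT_def U_GIT_def orbit_space_def eps_stable_points_def image_UN)
  have op: "openin (top_of_set A) (A \<inter> eps_stable_points \<iota> \<alpha> \<epsilon>)"
    if "\<epsilon> \<in> Theta" "A \<subseteq> semistable_set \<iota> \<alpha>" for A \<epsilon>
  proof -
    have "A \<inter> eps_stable_points \<iota> \<alpha> \<epsilon> = A \<inter> {p. eps_coords \<epsilon> p \<in> eps_semistable \<iota> \<alpha> \<epsilon>}"
      using that(2) by (auto simp: eps_stable_points_def semistable_set_def)
    then show ?thesis using open_eps_semistable_points[OF that(1)] by (auto simp: openin_open)
  qed
  have 2: "open_in_quotient (level_set \<iota> \<alpha>) (U M \<iota> \<alpha> \<epsilon>)" if "\<epsilon> \<in> Theta" for \<epsilon>
    unfolding open_in_quotient_def Union_U[OF that one M]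
    using op[OF that] level_set_semistable(2) by blast
  have 4: "open_in_quotient (semistable_set \<iota> \<alpha>) (U_GIT M \<iota> \<alpha> \<epsilon>)" if "\<epsilon> \<in> Theta" for \<epsilon>
    unfolding open_in_quotient_def Union_U_GIT[OF that one]
    using op[OF that order_refl] sub[OF that] by (simp add: Int_absorb1)
  show ?thesis by (intro conjI ballI 1 2 3 4 Th)
qed

end
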